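(* Let $\mathcal{H}$ be a separable infinite-dimensional complex Hilbert space and let $T\in\mathcal{B}(\mathcal{H})$. Then there is an orthonormal basis of $\mathcal{H}$ with respect to which the matrix of $T$ has staircase form, and with respect to any such basis the following hold. (1) The matrix of $T$ has the block tridiagonal form $$T=\begin{pmatrix} C_1 & A_1 & 0 & \\ B_1 & C_2 & A_2 & \\ 0 & B_2 & C_3 & \ddots\\ & & \ddots & \ddots\end{pmatrix},$$ where $C_1, A_1, B_1$ are $1\times 1$, $1\times 2$ and $2\times 1$ matrices, respectively, and for every $k\ge 2$, $C_k$ is a $2(3^{k-2})\times 2(3^{k-2})$ matrix, $A_k$ is a $2(3^{k-2})\times 2(3^{k-1})$ matrix, and $B_k$ is a $2(3^{k-1})\times 2(3^{k-2})$ matrix. (2) Alternatively, for any positive integer $n_1$, the matrix of $T$ has the same block tridiagonal form with $C_1, A_1, B_1$ of sizes $n_1\times n_1$, $n_1\times 2n_1$, $2n_1\times n_1$, respectively, and, for every $k\ge 2$, with $C_k, A_k, B_k$ of sizes $2(3^{k-2})n_1\times 2(3^{k-2})n_1$, $2(3^{k-2})n_1\times 2(3^{k-1})n_1$, $2(3^{k-1})n_1\times 2(3^{k-2})n_1$, respectively. (3) More generally, let $(n_k)_{k\ge 1}$ be a sequence of positive integers. The block tridiagonal pattern with diagonal block sizes $(n_k)$ covers all the staircase support positions if and only if $n_{k+1}\ge 2(n_1+n_2+\dots+n_k)$ for every $k\ge 1$ (with $n_1$ arbitrary).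
   Context: Matrix rows and columns are indexed by $1,2,3,\dots$. The matrix $(t_{ij})$ of an operator with respect to an orthonormal basis has staircase form if, for all $n$, row $n$ is supported in its first $3n$ entries and column $n$ is supported in its first $3n$ entries; i.e. $t_{ij}=0$ whenever $j>3i$ or $i>3j$. The staircase support positions are the positions $(i,j)$ with $j\le 3i$ and $i\le 3j$ (the actual entry there may be zero). Recalled fact (from earlier work): for every $T\in\mathcal{B}(\mathcal{H})$ and every orthonormal basis $\{e_n\}$ there is a unitary $U$ with $Ue_1=e_1$ and $e_n\in\operatorname{span}\{Ue_1,\dots,Ue_{3n}\}$ for all $n$ such that the matrix of $T$ in the basis $\{Ue_n\}$ has staircase form. For a sequence $(n_k)$ of positive integers, put $s_0=0$ and $s_k=n_1+\dots+n_k$, and let $I_k=\{s_{k-1}+1,\dots,s_k\}$. The block tridiagonal pattern with diagonal block sizes $(n_k)$ consists of the blocks $C_k$ (positions $I_k\times I_k$), $A_k$ (positions $I_k\times I_{k+1}$) and $B_k$ (positions $I_{k+1}\times I_k$), $k\ge1$; thus $C_k$ is $n_k\times n_k$, $A_k$ is $n_k\times n_{k+1}$, $B_k$ is $n_{k+1}\times n_k$. A matrix has block tridiagonal form with these sizes if all its entries outside these blocks are zero. The pattern covers a set of positions if every position in the set lies in one of these blocks. *)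

theory Defs
  imports "HOL-Analysis.Analysis"
begin

text \<open>Complex inner product spaces. The inner product is linear in its first argument.\<close>

class complex_inner = real_normed_vector +
  fixes scaleC :: "complex \<Rightarrow> 'a \<Rightarrow> 'a"  (infixr "*\<^sub>C" 75)
    and cinner :: "'a \<Rightarrow> 'a \<Rightarrow> complex"
  assumes scaleC_add_right: "a *\<^sub>C (x + y) = a *\<^sub>C x + a *\<^sub>C y"
    and scaleC_add_left: "(a + b) *\<^sub>C x = a *\<^sub>C x + b *\<^sub>C x"
    and scaleC_scaleC: "a *\<^sub>C (b *\<^sub>C x) = (a * b) *\<^sub>C x"
    and scaleC_one: "1 *\<^sub>C x = x"
    and scaleR_scaleC: "r *\<^sub>R x = complex_of_real r *\<^sub>C x"
    and cinner_commute: "cinner x y = cnj (cinner y x)"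
    and cinner_add_left: "cinner (x + y) z = cinner x z + cinner y z"
    and cinner_scaleC_left: "cinner (a *\<^sub>C x) y = a * cinner x y"
    and cinner_self_nonneg: "0 \<le> Re (cinner x x)"
    and cinner_eq_zero_iff: "cinner x x = 0 \<longleftrightarrow> x = 0"
    and norm_eq_sqrt_cinner: "norm x = sqrt (Re (cinner x x))"

class complex_hilbert_space = complex_inner + complete_space

interpretation complex_vector: vector_space "scaleC :: complex \<Rightarrow> 'a \<Rightarrow> 'a::complex_inner"
  by unfold_locales
    (simp_all add: scaleC_add_right scaleC_add_left scaleC_scaleC scaleC_one)

definition separable_type :: "'a::topological_space itself \<Rightarrow> bool" where
  "separable_type _ \<longleftrightarrow> (\<exists>D::'a set. countable D \<and> closure D = UNIV)"

definition infinite_dimensional :: "'a::complex_inner itself \<Rightarrow> bool" where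
  "infinite_dimensional _ \<longleftrightarrow> \<not> (\<exists>B::'a set. finite B \<and> complex_vector.span B = UNIV)"

definition bounded_operator :: "('a::complex_inner \<Rightarrow> 'a) \<Rightarrow> bool" where
  "bounded_operator T \<longleftrightarrow>
     Vector_Spaces.linear scaleC scaleC T \<and> (\<exists>K. \<forall>x. norm (T x) \<le> norm x * K)"

text \<open>Bases, matrices and size sequences are functions on \<^typ>\<open>nat\<close> whose relevant indices are
  \<open>1, 2, 3, \<dots>\<close>; the value at index \<open>0\<close> plays no role.\<close>

definition orthonormal_basis :: "(nat \<Rightarrow> 'a::complex_inner) \<Rightarrow> bool" where
  "orthonormal_basis e \<longleftrightarrow>
     (\<forall>i\<ge>1. \<forall>j\<ge>1. cinner (e i) (e j) = (if i = j then 1 else 0)) \<and>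
     closure (complex_vector.span (e ` {1..})) = UNIV"

definition op_matrix :: "(nat \<Rightarrow> 'a::complex_inner) \<Rightarrow> ('a \<Rightarrow> 'a) \<Rightarrow> nat \<Rightarrow> nat \<Rightarrow> complex" where
  "op_matrix e T i j = cinner (T (e j)) (e i)"

definition staircase_form :: "(nat \<Rightarrow> nat \<Rightarrow> complex) \<Rightarrow> bool" where
  "staircase_form t \<longleftrightarrow> (\<forall>i\<ge>1. \<forall>j\<ge>1. j > 3 * i \<or> i > 3 * j \<longrightarrow> t i j = 0)"

definition staircase_positions :: "(nat \<times> nat) set" where
  "staircase_positions = {(i, j). 1 \<le> i \<and> 1 \<le> j \<and> j \<le> 3 * i \<and> i \<le> 3 * j}"

definition partial_size :: "(nat \<Rightarrow> nat) \<Rightarrow> nat \<Rightarrow> nat" where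
  "partial_size n k = (\<Sum>l=1..k. n l)"

definition block_interval :: "(nat \<Rightarrow> nat) \<Rightarrow> nat \<Rightarrow> nat set" where
  "block_interval n k = {partial_size n (k - 1) + 1..partial_size n k}"

text \<open>The three products are the positions of \<open>C\<^sub>k\<close> (\<open>n k\<close> by \<open>n k\<close>),
  \<open>A\<^sub>k\<close> (\<open>n k\<close> by \<open>n (k + 1)\<close>) and \<open>B\<^sub>k\<close> (\<open>n (k + 1)\<close> by \<open>n k\<close>), so the sizes of all blocks are
  determined by the diagonal block sizes \<open>n\<close>.\<close>

definition block_tridiagonal_positions :: "(nat \<Rightarrow> nat) \<Rightarrow> (nat \<times> nat) set" where
  "block_tridiagonal_positions n =
     (\<Union>k\<in>{1..}. block_interval n k \<times> block_interval n k
             \<union> block_interval n k \<times> block_interval n (k + 1)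
             \<union> block_interval n (k + 1) \<times> block_interval n k)"

definition block_tridiagonal_form :: "(nat \<Rightarrow> nat) \<Rightarrow> (nat \<Rightarrow> nat \<Rightarrow> complex) \<Rightarrow> bool" where
  "block_tridiagonal_form n t \<longleftrightarrow>
     (\<forall>i\<ge>1. \<forall>j\<ge>1. (i, j) \<notin> block_tridiagonal_positions n \<longrightarrow> t i j = 0)"

end

theory Submission
  imports Defs
begin

text \<open>The basis is built by Gram-Schmidt: at the steps \<open>3k - 1\<close>, \<open>3k\<close> and \<open>3k + 1\<close> the vectors
  \<open>T e\<^sub>k\<close>, \<open>T\<^sup>* e\<^sub>k\<close> and the \<open>k\<close>-th member of a dense sequence are absorbed into the span; a step
  whose vector already lies in the span adds an arbitrary new unit vector instead. Then
  \<open>T e\<^sub>k\<close> and \<open>T\<^sup>* e\<^sub>k\<close> lie in the span of \<open>e\<^sub>1, \<dots>, e\<^bsub>3k\<^esub>\<close>, which is the staircase form.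
  For the patterns, the decisive positions are the corners \<open>(s\<^sub>k, 3 s\<^sub>k)\<close>: they are covered
  exactly when \<open>3 s\<^sub>k \<le> s\<^bsub>k + 1\<^esub>\<close>.\<close>

section \<open>Complex inner products\<close>

lemma cinner_add_right: "cinner x (y + z) = cinner x y + cinner x z"
  for x :: "'a::complex_inner"
  by (metis cinner_add_left cinner_commute complex_cnj_add)

lemma cinner_scaleC_right: "cinner x (a *\<^sub>C y) = cnj a * cinner x y"
  for x :: "'a::complex_inner"
  by (metis cinner_commute cinner_scaleC_left complex_cnj_mult)

lemma cinner_zero_left [simp]: "cinner 0 x = 0"
  for x :: "'a::complex_inner"
  using cinner_add_left[of 0 0 x] by simp

lemma cinner_minus_left: "cinner (- x) y = - cinner x y"
  for x :: "'a::complex_inner"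
  using cinner_add_left[of x "- x" y] by (simp add: eq_neg_iff_add_eq_0 add.commute)

lemma cinner_diff_left: "cinner (x - y) z = cinner x z - cinner y z"
  for x :: "'a::complex_inner"
  using cinner_add_left[of x "- y" z] by (simp add: cinner_minus_left)

lemma cinner_diff_right: "cinner x (y - z) = cinner x y - cinner x z"
  for x :: "'a::complex_inner"
  by (metis cinner_commute cinner_diff_left complex_cnj_diff)

lemma cinner_sum_left: "cinner (\<Sum>i\<in>A. g i) x = (\<Sum>i\<in>A. cinner (g i) x)"
  for x :: "'a::complex_inner"
  by (induction A rule: infinite_finite_induct) (simp_all add: cinner_add_left)

lemma cinner_scaleR_left: "cinner (r *\<^sub>R x) y = of_real r * cinner x y"
  for x :: "'a::complex_inner"
  by (simp add: scaleR_scaleC cinner_scaleC_left)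

lemma cinner_scaleR_right: "cinner x (r *\<^sub>R y) = of_real r * cinner x y"
  for x :: "'a::complex_inner"
  by (simp add: scaleR_scaleC cinner_scaleC_right)

lemma power2_norm_eq_cinner: "(norm x)\<^sup>2 = Re (cinner x x)"
  for x :: "'a::complex_inner"
  by (simp add: norm_eq_sqrt_cinner cinner_self_nonneg)

lemma cinner_self: "cinner x x = of_real ((norm x)\<^sup>2)"
  for x :: "'a::complex_inner"
proof -
  have "cinner x x = cnj (cinner x x)" by (rule cinner_commute)
  then have "Im (cinner x x) = 0" by (metis cnj.simps(2) neg_equal_zero)
  then show ?thesis by (simp add: complex_eq_iff power2_norm_eq_cinner)
qed

lemma Re_cinner_commute: "Re (cinner x y) = Re (cinner y x)"
  for x :: "'a::complex_inner"
  by (metis cinner_commute cnj.simps(1))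

lemma norm_add_sq: "(norm (x + y))\<^sup>2 = (norm x)\<^sup>2 + 2 * Re (cinner x y) + (norm y)\<^sup>2"
  for x :: "'a::complex_inner"
  using Re_cinner_commute[of x y]
  by (simp add: power2_norm_eq_cinner cinner_add_left cinner_add_right)

lemma norm_diff_sq: "(norm (x - y))\<^sup>2 = (norm x)\<^sup>2 - 2 * Re (cinner x y) + (norm y)\<^sup>2"
  for x :: "'a::complex_inner"
  using Re_cinner_commute[of x y]
  by (simp add: power2_norm_eq_cinner cinner_diff_left cinner_diff_right)

lemma norm_scaleC: "norm (a *\<^sub>C x) = norm a * norm x"
  for x :: "'a::complex_inner"
proof -
  have "cinner (a *\<^sub>C x) (a *\<^sub>C x) = (a * cnj a) * cinner x x"
    by (simp add: cinner_scaleC_left cinner_scaleC_right)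
  also have "\<dots> = of_real ((norm a * norm x)\<^sup>2)"
    by (simp only: complex_norm_square[symmetric] cinner_self power_mult_distrib of_real_mult)
  finally have "Re (cinner (a *\<^sub>C x) (a *\<^sub>C x)) = (norm a * norm x)\<^sup>2"
    by (simp only: Re_complex_of_real)
  then show ?thesis by (simp add: norm_eq_sqrt_cinner[of "a *\<^sub>C x"])
qed

text \<open>Expanding the squared norm of \<open>norm y *\<^sub>R x - norm x *\<^sub>R y\<close>
  leaves a positive multiple of the difference of the two sides.\<close>

lemma Re_cinner_le: "Re (cinner x y) \<le> norm x * norm y"
  for x :: "'a::complex_inner"
proof (cases "x = 0 \<or> y = 0")
  case True
  then show ?thesis using Re_cinner_commute[of x y] by auto
next
  case False
  then have pos: "norm x * norm y > 0" by simp
  have "0 \<le> (norm (norm y *\<^sub>R x - norm x *\<^sub>R y))\<^sup>2" by simp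
  also have "\<dots> = 2 * (norm x * norm y) * (norm x * norm y - Re (cinner x y))"
    unfolding norm_diff_sq
    by (simp add: cinner_scaleR_left cinner_scaleR_right power2_eq_square algebra_simps)
  finally show ?thesis using pos by (simp add: zero_le_mult_iff)
qed

text \<open>Cauchy-Schwarz: a unimodular factor \<open>a\<close> rotates \<open>cinner x y\<close>
  onto the nonnegative real axis, where the bound on real parts applies.\<close>

lemma norm_cinner_le: "norm (cinner x y) \<le> norm x * norm y"
  for x :: "'a::complex_inner"
proof (cases "cinner x y = 0")
  case False
  define z where "z = cinner x y"
  define a where "a = cnj z / of_real (norm z)"
  have "z \<noteq> 0" using False by (simp add: z_def)
  then have "norm a = 1" by (simp add: a_def norm_divide)
  have "a * z = of_real (norm z)"
    using \<open>z \<noteq> 0\<close> complex_norm_square[of z]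
    by (simp add: a_def divide_simps power2_eq_square mult.commute)
  then have "norm z = Re (cinner (a *\<^sub>C x) y)"
    by (simp add: cinner_scaleC_left z_def)
  also have "\<dots> \<le> norm x * norm y"
    using Re_cinner_le[of "a *\<^sub>C x" y] \<open>norm a = 1\<close> by (simp add: norm_scaleC)
  finally show ?thesis by (simp add: z_def)
qed simp

section \<open>The adjoint\<close>

text \<open>The representing vector minimizes \<open>\<parallel>x\<parallel>\<^sup>2 - 2 Re (f x)\<close>; by the parallelogram law every minimizing
  sequence is Cauchy.\<close>

lemma riesz_representation:
  fixes f :: "'a::complex_hilbert_space \<Rightarrow> complex"
  assumes add: "\<And>x y. f (x + y) = f x + f y"
    and scale: "\<And>a x. f (a *\<^sub>C x) = a * f x"
    and bound: "\<And>x. norm (f x) \<le> norm x * K"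
  obtains y where "\<And>x. f x = cinner x y"
proof -
  define J where "J x = (norm x)\<^sup>2 - 2 * Re (f x)" for x
  have scaleR: "f (r *\<^sub>R x) = of_real r * f x" for r x
    by (simp add: scaleR_scaleC scale)
  have bl: "bounded_linear f"
    by (rule bounded_linear_intro[of _ K]) (simp_all add: add scaleR bound scaleR_conv_of_real)
  \<comment> \<open>Completing the square in \<open>norm x\<close> bounds \<open>J\<close> below, so
    its infimum is finite.\<close>
  have "J x \<ge> - K\<^sup>2" for x
  proof -
    have "Re (f x) \<le> norm x * K" using bound[of x] complex_Re_le_cmod[of "f x"] by linarith
    moreover have "0 \<le> (norm x - K)\<^sup>2" by simp
    ultimately show ?thesis unfolding J_def power2_diff by linarith
  qed
  then have bdd: "bdd_below (range J)" by (auto simp: bdd_below_def)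
  define m where "m = (INF x. J x)"
  have m_le: "m \<le> J x" for x unfolding m_def using bdd by (simp add: cINF_lower)
  have "\<exists>x. J x < m + inverse (real (Suc n))" for n
    using cInf_lessD[of "range J" "m + inverse (real (Suc n))"] by (auto simp: m_def)
  then obtain X where X: "\<And>n. J (X n) < m + inverse (real (Suc n))" by metis
  \<comment> \<open>The parallelogram law, applied with the midpoint \<open>z\<close>, where
    \<open>J z\<close> is at least \<open>m\<close>.\<close>
  have par: "(norm (x - y))\<^sup>2 \<le> 2 * J x + 2 * J y - 4 * m" for x y
  proof -
    define z where "z = (1/2) *\<^sub>R (x + y)"
    have "J z = (norm (x + y))\<^sup>2 / 4 - Re (f x) - Re (f y)"
      unfolding J_def z_def scaleR add by (simp add: power_divide add_divide_distrib)
    then have "(norm (x - y))\<^sup>2 = 2 * J x + 2 * J y - 4 * J z"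
      by (simp add: J_def[of x] J_def[of y] norm_add_sq norm_diff_sq add_divide_distrib)
    then show ?thesis using m_le[of z] by simp
  qed
  have "Cauchy X"
  proof (rule metric_CauchyI)
    fix \<epsilon> :: real assume "0 < \<epsilon>"
    then obtain N where N: "inverse (real (Suc N)) < \<epsilon>\<^sup>2 / 4"
      using reals_Archimedean[of "\<epsilon>\<^sup>2 / 4"] by auto
    have near: "J (X n) < m + \<epsilon>\<^sup>2 / 4" if "n \<ge> N" for n
    proof -
      have "inverse (real (Suc n)) \<le> inverse (real (Suc N))"
        using that by (intro le_imp_inverse_le) auto
      then show ?thesis using X[of n] N by linarith
    qed
    have "dist (X p) (X q) < \<epsilon>" if "p \<ge> N" "q \<ge> N" for p q
    proof -
      have "(norm (X p - X q))\<^sup>2 < \<epsilon>\<^sup>2"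
        by (rule le_less_trans[OF par]) (use near[OF that(1)] near[OF that(2)] in linarith)
      then show ?thesis using \<open>0 < \<epsilon>\<close> by (simp add: dist_norm power2_less_imp_less)
    qed
    then show "\<exists>M. \<forall>p\<ge>M. \<forall>q\<ge>M. dist (X p) (X q) < \<epsilon>" by blast
  qed
  then obtain y where y: "X \<longlonglongrightarrow> y"
    using Cauchy_convergent_iff convergent_def by blast
  have "(\<lambda>n. J (X n)) \<longlonglongrightarrow> J y"
    unfolding J_def by (intro tendsto_intros y bounded_linear.tendsto[OF bl])
  moreover have "(\<lambda>n. m + inverse (real (Suc n))) \<longlonglongrightarrow> m + 0"
    by (intro tendsto_add tendsto_const LIMSEQ_inverse_real_of_nat)
  ultimately have "J y \<le> m + 0"
    by (rule LIMSEQ_le) (use X in \<open>auto intro: less_imp_le\<close>)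
  then have min: "J y \<le> J z" for z using m_le[of z] by linarith
  have Re_eq: "Re (f x) = Re (cinner x y)" for x
  proof (cases "x = 0")
    case True
    then show ?thesis using scale[of 0 0] by simp
  next
    case False
    define c where "c = Re (cinner x y) - Re (f x)"
    \<comment> \<open>The minimizer of the quadratic
      \<open>2 * t * c + t\<^sup>2 * (norm x)\<^sup>2\<close> in \<open>t\<close>; its value there
      is negative unless \<open>c\<close> vanishes.\<close>
    define t where "t = - c / (norm x)\<^sup>2"
    have "J (y + t *\<^sub>R x) = J y + 2 * t * c + t\<^sup>2 * (norm x)\<^sup>2"
      using Re_cinner_commute[of x y]
      unfolding J_def norm_add_sq add scaleR c_def
      by (simp add: cinner_scaleR_right power_mult_distrib algebra_simps)
    then have "0 \<le> 2 * t * c + t\<^sup>2 * (norm x)\<^sup>2" using min[of "y + t *\<^sub>R x"] by simp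
    also have "\<dots> = - (c\<^sup>2 / (norm x)\<^sup>2)"
      using False by (simp add: t_def field_simps power2_eq_square)
    finally have "c\<^sup>2 / (norm x)\<^sup>2 \<le> 0" by simp
    then have "c = 0" using False by (simp add: divide_le_0_iff)
    then show ?thesis by (simp add: c_def)
  qed
  \<comment> \<open>Real parts at \<open>\<i> *\<^sub>C x\<close> are the negated imaginary parts at
    \<open>x\<close>.\<close>
  have "f x = cinner x y" for x
    using Re_eq[of x] Re_eq[of "\<i> *\<^sub>C x"]
    by (simp add: complex_eq_iff scale cinner_scaleC_left)
  then show thesis by (rule that)
qed

text \<open>For each fixed \<open>y\<close>, Cauchy-Schwarz makes \<open>cinner (T x) y\<close> a
  bounded functional of \<open>x\<close>; its representing vector is taken as
  \<open>S y\<close>.\<close>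

lemma adjoint_exists:
  fixes T :: "'a::complex_hilbert_space \<Rightarrow> 'a"
  assumes "bounded_operator T"
  shows "\<exists>S. \<forall>x y. cinner (T x) y = cinner x (S y)"
proof -
  from assms obtain K where lin: "Vector_Spaces.linear scaleC scaleC T"
    and K: "\<And>x. norm (T x) \<le> norm x * K"
    unfolding bounded_operator_def by blast
  interpret T: Vector_Spaces.linear scaleC scaleC T by (rule lin)
  have "\<exists>z. \<forall>x. cinner (T x) y = cinner x z" for y
  proof (rule riesz_representation[of "\<lambda>x. cinner (T x) y" "K * norm y"])
    show "norm (cinner (T x) y) \<le> norm x * (K * norm y)" for x
      using norm_cinner_le[of "T x" y] mult_right_mono[OF K[of x] norm_ge_zero[of y]]
      by (simp add: mult.assoc)
  qed (auto simp: T.add T.scale cinner_add_left cinner_scaleC_left)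
  then show ?thesis by metis
qed

section \<open>Existence of a staircase basis\<close>

lemma cinner_span_eq_0:
  fixes x :: "'a::complex_inner"
  assumes "x \<in> complex_vector.span B" and "\<And>b. b \<in> B \<Longrightarrow> cinner b z = 0"
  shows "cinner x z = 0"
  using assms(1)
  by (induction rule: complex_vector.span_induct_alt)
    (simp_all add: cinner_add_left cinner_scaleC_left assms(2))

text \<open>Subtracting the orthogonal projection \<open>p\<close> from \<open>w\<close> leaves a
  nonzero residual \<open>r\<close> orthogonal to \<open>B\<close>; normalizing it gives
  \<open>u\<close>, and \<open>w\<close> is recovered as \<open>p\<close> plus a multiple of
  \<open>u\<close>.\<close>

lemma gram_schmidt_residual:
  fixes B :: "'a::complex_inner set"
  assumes "finite B" and "\<And>x y. x \<in> B \<Longrightarrow> y \<in> B \<Longrightarrow> cinner x y = (if x = y then 1 else 0)"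
    and "w \<notin> complex_vector.span B"
  obtains u where "cinner u u = 1" and "\<And>b. b \<in> B \<Longrightarrow> cinner u b = 0"
    and "w \<in> complex_vector.span (insert u B)"
proof -
  define p where "p = (\<Sum>b\<in>B. cinner w b *\<^sub>C b)"
  define r where "r = w - p"
  define u where "u = inverse (norm r) *\<^sub>R r"
  have p: "p \<in> complex_vector.span B"
    unfolding p_def by (intro complex_vector.span_sum complex_vector.span_scale
        complex_vector.span_base)
  then have "r \<noteq> 0" using assms(3) by (auto simp: r_def)
  have "cinner p b = cinner w b" if "b \<in> B" for b
  proof -
    have "cinner p b = (\<Sum>c\<in>B. if c = b then cinner w c else 0)"
      unfolding p_def cinner_sum_left using that assms(2)
      by (intro sum.cong) (auto simp: cinner_scaleC_left)
    then show ?thesis using that assms(1) by simp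
  qed
  then have "cinner u b = 0" if "b \<in> B" for b
    using that by (simp add: u_def r_def cinner_scaleR_left cinner_diff_left)
  moreover have "cinner u u = 1"
  proof -
    have "norm u = 1" using \<open>r \<noteq> 0\<close> by (simp add: u_def)
    then show ?thesis by (simp add: cinner_self)
  qed
  moreover have "w \<in> complex_vector.span (insert u B)"
  proof -
    have "w = p + of_real (norm r) *\<^sub>C u"
      using \<open>r \<noteq> 0\<close> by (simp add: scaleR_scaleC[symmetric] u_def r_def)
    moreover have "p \<in> complex_vector.span (insert u B)"
      using p complex_vector.span_mono[of B "insert u B"] by blast
    ultimately show ?thesis
      by (metis complex_vector.span_add complex_vector.span_scale complex_vector.span_base insertI1)
  qed
  ultimately show thesis using that by blast
qed

text \<open>If \<open>w\<close> is already in the span, infinite dimension supplies some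
  \<open>v\<close> outside it, and the residual of \<open>v\<close> is added instead, so a new unit
  vector always exists.\<close>

lemma gram_schmidt_step:
  fixes B :: "'a::complex_inner set"
  assumes "infinite_dimensional TYPE('a)" and "finite B"
    and "\<And>x y. x \<in> B \<Longrightarrow> y \<in> B \<Longrightarrow> cinner x y = (if x = y then 1 else 0)"
  shows "\<exists>u. cinner u u = 1 \<and> (\<forall>b\<in>B. cinner u b = 0) \<and> w \<in> complex_vector.span (insert u B)"
proof (cases "w \<in> complex_vector.span B")
  case True
  obtain v where "v \<notin> complex_vector.span B"
    using assms(1,2) unfolding infinite_dimensional_def by blast
  then obtain u where "cinner u u = 1" "\<And>b. b \<in> B \<Longrightarrow> cinner u b = 0"
    using gram_schmidt_residual[OF assms(2,3)] by metis
  moreover have "w \<in> complex_vector.span (insert u B)"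
    using True complex_vector.span_mono[of B "insert u B"] by blast
  ultimately show ?thesis by blast
next
  case False
  then show ?thesis using gram_schmidt_residual[OF assms(2,3)] by metis
qed

text \<open>The vector \<open>w f n\<close> to be absorbed at step \<open>n\<close> may depend on the vectors constructed before.\<close>

lemma adaptive_gram_schmidt:
  fixes w :: "(nat \<Rightarrow> 'a::complex_inner) \<Rightarrow> nat \<Rightarrow> 'a"
  assumes "infinite_dimensional TYPE('a)"
    and "\<And>f g n. n \<ge> 1 \<Longrightarrow> (\<And>i. 1 \<le> i \<Longrightarrow> i < n \<Longrightarrow> f i = g i) \<Longrightarrow> w f n = w g n"
  shows "\<exists>e. (\<forall>i\<ge>1. \<forall>j\<ge>1. cinner (e i) (e j) = (if i = j then 1 else 0)) \<and>
    (\<forall>n\<ge>1. w e n \<in> complex_vector.span (e ` {1..n}))"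
proof -
  \<comment> \<open>\<open>P f n r\<close> says that \<open>r\<close> is admissible as the
    \<open>n\<close>-th vector after \<open>f\<close> on \<open>{1..<n}\<close>. It is vacuous at
    \<open>n = 0\<close>, since bases are indexed from 1.\<close>
  define P where "P f n r \<longleftrightarrow> (n \<ge> 1 \<longrightarrow> cinner r r = 1 \<and> (\<forall>b\<in>f ` {1..<n}. cinner r b = 0) \<and>
      w f n \<in> complex_vector.span (insert r (f ` {1..<n})))" for f n and r :: 'a
  \<comment> \<open>\<open>P\<close> only compares a vector with earlier ones; the other order
    follows by conjugate symmetry.\<close>
  have orth: "cinner (f i) (f j) = (if i = j then 1 else 0)"
    if P: "\<And>k. k < n \<Longrightarrow> P f k (f k)" and "1 \<le> i" "i < n" "1 \<le> j" "j < n" for f n i j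
  proof (cases i j rule: linorder_cases)
    case less
    then have "cinner (f j) (f i) = 0" using P[OF \<open>j < n\<close>] that by (simp add: P_def)
    then show ?thesis using less cinner_commute[of "f i" "f j"] by simp
  next
    case equal
    then show ?thesis using P[OF \<open>i < n\<close>] that by (simp add: P_def)
  next
    case greater
    then show ?thesis using P[OF \<open>i < n\<close>] that by (simp add: P_def)
  qed
  have "\<exists>e. \<forall>n. P e n (e n)"
  \<comment> \<open>Course-of-values recursion: the first goal is that \<open>P f n\<close> depends
    on \<open>f\<close> only below \<open>n\<close>, the second that an admissible vector
    exists.\<close>
  proof (rule dependent_wellorder_choice)
    fix r :: 'a and f g :: "nat \<Rightarrow> 'a" and n :: nat
    assume eq: "\<And>i. i < n \<Longrightarrow> f i = g i"
    have "f ` {1..<n} = g ` {1..<n}" using eq by auto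
    moreover have "w f n = w g n" if "n \<ge> 1" using assms(2)[OF that] eq by blast
    ultimately show "P f n r = P g n r" by (auto simp: P_def)
  next
    fix f :: "nat \<Rightarrow> 'a" and n :: nat
    assume IH: "\<And>i. i < n \<Longrightarrow> P f i (f i)"
    have "cinner x y = (if x = y then 1 else 0)"
      if "x \<in> f ` {1..<n}" and "y \<in> f ` {1..<n}" for x y
    proof -
      obtain i where "x = f i" and i: "1 \<le> i" "i < n"
        using \<open>x \<in> f ` {1..<n}\<close> by auto
      moreover obtain j where "y = f j" and j: "1 \<le> j" "j < n"
        using \<open>y \<in> f ` {1..<n}\<close> by auto
      \<comment> \<open>Distinct indices must give distinct vectors, since the Gram-Schmidt step
        takes a set rather than a family.\<close>
      moreover have "f i \<noteq> f j" if "i \<noteq> j"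
        using orth[of n f i j, OF IH] orth[of n f i i, OF IH] i j that by auto
      ultimately show ?thesis using orth[of n f i j, OF IH] i j by auto
    qed
    then show "\<exists>r. P f n r"
      using gram_schmidt_step[OF assms(1), of "f ` {1..<n}" "w f n"] by (auto simp: P_def)
  qed
  then obtain e where e: "\<And>n. P e n (e n)" by blast
  show ?thesis
  proof (intro exI[of _ e] conjI allI impI)
    show "cinner (e i) (e j) = (if i = j then 1 else 0)" if "i \<ge> 1" "j \<ge> 1" for i j
      using orth[of "Suc (max i j)" e i j, OF e] that by auto
    show "w e n \<in> complex_vector.span (e ` {1..n})" if "n \<ge> 1" for n
    proof -
      have "{1..n} = insert n {1..<n}" using that by auto
      then show ?thesis using e[of n] that by (simp add: P_def)
    qed
  qed
qed

section \<open>The staircase basis of an operator\<close>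

lemma staircase_basis_exists:
  fixes T :: "'a::complex_hilbert_space \<Rightarrow> 'a"
  assumes "separable_type TYPE('a)" and "infinite_dimensional TYPE('a)" and "bounded_operator T"
  shows "\<exists>e. orthonormal_basis e \<and> staircase_form (op_matrix e T)"
proof -
  obtain S where S: "\<And>x y. cinner (T x) y = cinner x (S y)"
    using adjoint_exists[OF assms(3)] by blast
  obtain D :: "'a set" where D: "countable D" "closure D = UNIV"
    using assms(1) unfolding separable_type_def by blast
  then have "D \<noteq> {}" by auto
  with D(1) obtain d :: "nat \<Rightarrow> 'a" where d: "range d = D"
    using range_from_nat_into by metis
  \<comment> \<open>For \<open>k \<ge> 1\<close>, residues 2, 0 and 1 mod 3 encode the steps
    \<open>3 * k - 1\<close>, \<open>3 * k\<close> and \<open>3 * k + 1\<close>; the dense sequence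
    starts at \<open>d 0\<close>, absorbed at step 1.\<close>
  define w where "w f n = (if n mod 3 = 2 then T (f ((n + 1) div 3))
      else if n mod 3 = 0 then S (f (n div 3)) else d (n div 3))" for f n
  \<comment> \<open>The index consulted is some \<open>k \<ge> 1\<close> with
    \<open>n = 3 * k - 1\<close> or \<open>n = 3 * k\<close>, hence smaller than
    \<open>n\<close>.\<close>
  have w_cong: "w f n = w g n" if "n \<ge> 1" "\<And>i. 1 \<le> i \<Longrightarrow> i < n \<Longrightarrow> f i = g i" for f g n
  proof -
    have "f ((n + 1) div 3) = g ((n + 1) div 3)" if "n mod 3 = 2"
      using that by (intro \<open>\<And>i. 1 \<le> i \<Longrightarrow> i < n \<Longrightarrow> f i = g i\<close>) presburger+
    moreover have "f (n div 3) = g (n div 3)" if "n mod 3 = 0"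
      using that \<open>n \<ge> 1\<close> by (intro \<open>\<And>i. 1 \<le> i \<Longrightarrow> i < n \<Longrightarrow> f i = g i\<close>) presburger+
    ultimately show ?thesis by (simp add: w_def)
  qed
  obtain e
    where orth: "\<And>i j. i \<ge> 1 \<Longrightarrow> j \<ge> 1 \<Longrightarrow> cinner (e i) (e j) = (if i = j then 1 else 0)"
      and w: "\<And>n. n \<ge> 1 \<Longrightarrow> w e n \<in> complex_vector.span (e ` {1..n})"
    using adaptive_gram_schmidt[OF assms(2), of w, OF w_cong] by blast
  have "d k \<in> complex_vector.span (e ` {1..})" for k
  proof -
    have "w e (3 * k + 1) = d k"
    proof -
      have "(3 * k + 1) mod 3 = 1" "(3 * k + 1) div 3 = k" by presburger+
      then show ?thesis by (simp add: w_def)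
    qed
    then show ?thesis
      using w[of "3 * k + 1"] complex_vector.span_mono[OF image_mono, of "{1..3 * k + 1}" "{1..}" e] by auto
  qed
  then have "D \<subseteq> complex_vector.span (e ` {1..})" using d by auto
  then have "closure (complex_vector.span (e ` {1..})) = UNIV"
    using closure_mono D(2) by blast
  with orth have basis: "orthonormal_basis e" by (simp add: orthonormal_basis_def)
  have vanish: "cinner x (e i) = 0"
    if "x \<in> complex_vector.span (e ` {1..m})" "i > m" for x i m
    using that(1) by (rule cinner_span_eq_0) (use orth that(2) in auto)
  have "op_matrix e T i j = 0" if "i \<ge> 1" "j \<ge> 1" "j > 3 * i \<or> i > 3 * j" for i j
    using that(3)
  proof
    \<comment> \<open>Row \<open>i\<close> consists of the conjugated coordinates of
      \<open>S (e i)\<close>.\<close>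
    assume "j > 3 * i"
    have "w e (3 * i) = S (e i)" unfolding w_def by simp
    with w[of "3 * i"] \<open>i \<ge> 1\<close> have "S (e i) \<in> complex_vector.span (e ` {1..3 * i})" by simp
    then have "cinner (S (e i)) (e j) = 0" using \<open>j > 3 * i\<close> by (rule vanish)
    then show ?thesis
      using cinner_commute[of "e j" "S (e i)"] by (simp add: op_matrix_def S)
  next
    \<comment> \<open>Column \<open>j\<close> consists of the coordinates of
      \<open>T (e j)\<close>.\<close>
    assume "i > 3 * j"
    have "w e (3 * j - 1) = T (e j)"
    proof -
      \<comment> \<open>This turns the truncated subtraction \<open>3 * j - 1\<close> into
        \<open>3 * m + 2\<close>.\<close>
      obtain m where m: "j = Suc m" using \<open>j \<ge> 1\<close> by (cases j) auto
      have "(3 * m + 2) mod 3 = 2" by presburger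
      then show ?thesis by (simp add: w_def m)
    qed
    with w[of "3 * j - 1"] \<open>j \<ge> 1\<close> have "T (e j) \<in> complex_vector.span (e ` {1..3 * j - 1})" by simp
    then show ?thesis using \<open>i > 3 * j\<close> by (simp add: op_matrix_def vanish)
  qed
  then have "staircase_form (op_matrix e T)" unfolding staircase_form_def by blast
  with basis show ?thesis by blast
qed

section \<open>Block tridiagonal patterns\<close>

lemma partial_size_0 [simp]: "partial_size n 0 = 0"
  by (simp add: partial_size_def)

lemma partial_size_Suc [simp]: "partial_size n (Suc k) = partial_size n k + n (Suc k)"
  by (simp add: partial_size_def)

lemma partial_size_mono: "k \<le> l \<Longrightarrow> partial_size n k \<le> partial_size n l"
  by (rule lift_Suc_mono_le) simp_all

lemma block_interval_Suc: "block_interval n (Suc k) = {partial_size n k + 1..partial_size n (Suc k)}"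
  by (simp add: block_interval_def)

lemma le_partial_size:
  assumes "\<forall>k\<ge>1. n k > 0"
  shows "k \<le> partial_size n k"
proof (induction k)
  case (Suc k)
  have "n (Suc k) > 0" using assms by simp
  with Suc show ?case by simp
qed simp

text \<open>Positive sizes make the partial sums unbounded, so a least one reaching \<open>i\<close>
  exists; it is not the zeroth, which is 0.\<close>

lemma block_interval_exists:
  assumes "\<forall>k\<ge>1. n k > 0" and "i \<ge> 1"
  obtains k where "i \<in> block_interval n (Suc k)"
proof -
  define l where "l = (LEAST l. i \<le> partial_size n l)"
  have l: "i \<le> partial_size n l"
    unfolding l_def using le_partial_size[OF assms(1), of i] by (rule LeastI)
  then obtain k where k: "l = Suc k" using assms(2) by (cases l) auto
  then have "\<not> i \<le> partial_size n k" unfolding l_def by (intro not_less_Least) simp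
  then show thesis using l k by (intro that[of k]) (simp add: block_interval_Suc)
qed

lemma block_interval_unique:
  assumes "i \<in> block_interval n (Suc k)" and "i \<in> block_interval n (Suc l)"
  shows "k = l"
proof (rule ccontr)
  assume "k \<noteq> l"
  then consider "Suc k \<le> l" | "Suc l \<le> k" by linarith
  then show False
    using assms partial_size_mono[of "Suc k" l n] partial_size_mono[of "Suc l" k n]
    by cases (auto simp: block_interval_Suc)
qed

text \<open>Indexing blocks by \<open>Suc k\<close> removes the truncated \<open>k - 1\<close> from
  their left ends.\<close>

lemma block_tridiagonal_positions_iff:
  "(i, j) \<in> block_tridiagonal_positions n \<longleftrightarrow>
    (\<exists>k. i \<in> block_interval n (Suc k) \<and> j \<in> block_interval n (Suc k) \<or>
         i \<in> block_interval n (Suc k) \<and> j \<in> block_interval n (Suc (Suc k)) \<or>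
         i \<in> block_interval n (Suc (Suc k)) \<and> j \<in> block_interval n (Suc k))"
proof -
  have "{1::nat..} = range Suc" by (auto simp: image_iff Suc_le_eq gr0_conv_Suc)
  then show ?thesis unfolding block_tridiagonal_positions_def by auto
qed

lemma block_tridiagonal_positions_sym:
  "(i, j) \<in> block_tridiagonal_positions n \<longleftrightarrow> (j, i) \<in> block_tridiagonal_positions n"
  unfolding block_tridiagonal_positions_iff by blast

text \<open>With \<open>s = partial_size n\<close>, the growth condition reads
  \<open>3 * s k \<le> s (k + 1)\<close>. Conversely to the corner argument, a row \<open>i\<close>
  in block \<open>k\<close> has \<open>3 * i \<le> 3 * s k \<le> s (k + 1)\<close>, so its support
  ends no later than block \<open>k + 1\<close>.\<close>

theorem staircase_covered_iff:
  assumes pos: "\<forall>k\<ge>1. n k > 0"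
  shows "staircase_positions \<subseteq> block_tridiagonal_positions n \<longleftrightarrow>
    (\<forall>k\<ge>1. n (k + 1) \<ge> 2 * (\<Sum>l=1..k. n l))"
proof
  assume sub: "staircase_positions \<subseteq> block_tridiagonal_positions n"
  show "\<forall>k\<ge>1. n (k + 1) \<ge> 2 * (\<Sum>l=1..k. n l)"
  proof (intro allI impI)
    fix k :: nat assume "k \<ge> 1"
    then obtain m where m: "k = Suc m" by (cases k) auto
    define s where "s = partial_size n k"
    have "s \<ge> 1" using le_partial_size[OF pos, of k] \<open>k \<ge> 1\<close> by (simp add: s_def)
    then have "(s, 3 * s) \<in> block_tridiagonal_positions n"
      using sub by (auto simp: staircase_positions_def)
    \<comment> \<open>A nonempty block contains its right end \<open>s\<close>.\<close>
    moreover have "n (Suc m) > 0" using pos by simp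
    then have s: "s \<in> block_interval n (Suc m)" by (simp add: s_def m block_interval_Suc)
    \<comment> \<open>In all three kinds of block, the column block is at most one beyond the row
      block, which is unique.\<close>
    ultimately consider l where "l \<le> Suc m" "3 * s \<in> block_interval n (Suc l)"
      unfolding block_tridiagonal_positions_iff
      by (metis block_interval_unique le_Suc_eq order_refl)
    then have "3 * s \<le> partial_size n (Suc (Suc m))"
    proof cases
      case 1
      then have "3 * s \<le> partial_size n (Suc l)" by (simp add: block_interval_Suc)
      also have "\<dots> \<le> partial_size n (Suc (Suc m))" using 1 by (intro partial_size_mono) simp
      finally show ?thesis .
    qed
    also have "\<dots> = s + n (k + 1)" by (simp add: s_def m)
    finally show "n (k + 1) \<ge> 2 * (\<Sum>l=1..k. n l)" by (simp add: s_def partial_size_def)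
  qed
next
  assume grow: "\<forall>k\<ge>1. n (k + 1) \<ge> 2 * (\<Sum>l=1..k. n l)"
  have upper: "(i, j) \<in> block_tridiagonal_positions n" if "1 \<le> i" "i \<le> j" "j \<le> 3 * i" for i j
  proof -
    obtain k where k: "i \<in> block_interval n (Suc k)"
      using block_interval_exists[OF pos \<open>1 \<le> i\<close>] .
    have "3 * partial_size n (Suc k) \<le> partial_size n (Suc (Suc k))"
      using grow[rule_format, of "Suc k"] by (simp add: partial_size_def)
    \<comment> \<open>The bound \<open>i \<le> j\<close> excludes earlier blocks, and
      \<open>j \<le> 3 * i\<close> excludes those after the next one.\<close>
    with k that have "j \<in> block_interval n (Suc k) \<or> j \<in> block_interval n (Suc (Suc k))"
      by (simp add: block_interval_Suc del: partial_size_Suc) linarith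
    with k show ?thesis unfolding block_tridiagonal_positions_iff by blast
  qed
  show "staircase_positions \<subseteq> block_tridiagonal_positions n"
  proof
    fix x assume "x \<in> staircase_positions"
    then obtain i j where x: "x = (i, j)" and "1 \<le> i" "1 \<le> j" "j \<le> 3 * i" "i \<le> 3 * j"
      by (auto simp: staircase_positions_def)
    then show "x \<in> block_tridiagonal_positions n"
      \<comment> \<open>Support and pattern are both symmetric, so entries below the diagonal reduce
        to those above.\<close>
      using upper[of i j] upper[of j i] block_tridiagonal_positions_sym[of i j n]
      by (cases "i \<le> j") auto
  qed
qed

section \<open>Block form of staircase matrices\<close>

lemma staircase_imp_block_tridiagonal:
  assumes "staircase_form t" and "staircase_positions \<subseteq> block_tridiagonal_positions n"
  shows "block_tridiagonal_form n t"
  unfolding block_tridiagonal_form_def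
proof (intro allI impI)
  fix i j :: nat assume "1 \<le> i" "1 \<le> j" "(i, j) \<notin> block_tridiagonal_positions n"
  then have "(i, j) \<notin> staircase_positions" using assms(2) by blast
  then have "j > 3 * i \<or> i > 3 * j" using \<open>1 \<le> i\<close> \<open>1 \<le> j\<close> by (auto simp: staircase_positions_def)
  then show "t i j = 0" using assms(1) \<open>1 \<le> i\<close> \<open>1 \<le> j\<close> by (auto simp: staircase_form_def)
qed

lemma staircase_covered_geometric:
  fixes n1 :: nat
  assumes "n1 \<ge> 1"
  shows "staircase_positions \<subseteq>
    block_tridiagonal_positions (\<lambda>k. if k = 1 then n1 else 2 * 3 ^ (k - 2) * n1)"
    (is "_ \<subseteq> block_tridiagonal_positions ?n")
proof -
  \<comment> \<open>Each new size is twice the sum of its predecessors, so the partial sums triple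
    and the growth condition holds with equality.\<close>
  have sum: "(\<Sum>l=1..Suc m. ?n l) = 3 ^ m * n1" for m
    by (induction m) simp_all
  have "2 * (\<Sum>l=1..k. ?n l) \<le> ?n (k + 1)" if k: "k \<ge> 1" for k
  proof -
    obtain m where "k = Suc m" using k by (cases k) auto
    then show ?thesis using sum[of m] by simp
  qed
  moreover have "\<forall>k\<ge>1. ?n k > 0" using assms by simp
  ultimately show ?thesis using staircase_covered_iff[of ?n] by blast
qed

theorem theorem2p4:
  fixes T :: "'a::complex_hilbert_space \<Rightarrow> 'a"
  assumes "separable_type TYPE('a)"
    and "infinite_dimensional TYPE('a)"
    and "bounded_operator T"
  shows "(\<exists>e. orthonormal_basis e \<and> staircase_form (op_matrix e T)) \<and>
    (\<forall>e. orthonormal_basis e \<and> staircase_form (op_matrix e T) \<longrightarrow>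
       block_tridiagonal_form (\<lambda>k. if k = 1 then 1 else 2 * 3 ^ (k - 2)) (op_matrix e T) \<and>
       (\<forall>n1\<ge>1. block_tridiagonal_form
                 (\<lambda>k. if k = 1 then n1 else 2 * 3 ^ (k - 2) * n1) (op_matrix e T)) \<and>
       (\<forall>n::nat \<Rightarrow> nat. (\<forall>k\<ge>1. n k > 0) \<longrightarrow>
          (staircase_positions \<subseteq> block_tridiagonal_positions n \<longleftrightarrow>
             (\<forall>k\<ge>1. n (k + 1) \<ge> 2 * (\<Sum>l=1..k. n l)))))"
proof (intro conjI allI impI)
  show "\<exists>e. orthonormal_basis e \<and> staircase_form (op_matrix e T)"
    using assms by (rule staircase_basis_exists)
next
  fix e assume e: "orthonormal_basis e \<and> staircase_form (op_matrix e T)"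
  show "block_tridiagonal_form (\<lambda>k. if k = 1 then n1 else 2 * 3 ^ (k - 2) * n1) (op_matrix e T)"
    if "n1 \<ge> 1" for n1
    using e staircase_covered_geometric[OF that] by (blast intro: staircase_imp_block_tridiagonal)
  \<comment> \<open>Reflexivity instantiates \<open>n1\<close> to 1; only the factor
    \<open>* 1\<close> remains to be removed.\<close>
  from this[OF order_refl]
  show "block_tridiagonal_form (\<lambda>k. if k = 1 then 1 else 2 * 3 ^ (k - 2)) (op_matrix e T)"
    by (simp only: mult_1_right)
next
  fix n :: "nat \<Rightarrow> nat" assume "\<forall>k\<ge>1. n k > 0"
  then show "staircase_positions \<subseteq> block_tridiagonal_positions n \<longleftrightarrow>
      (\<forall>k\<ge>1. n (k + 1) \<ge> 2 * (\<Sum>l=1..k. n l))"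
    by (rule staircase_covered_iff)
qed

end
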